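(* Let $(X,*_X,0_X)$ and $(Y,*_Y,0_Y)$ be BCK/BCI-algebras and let $h:X\to Y$ be a homomorphism. Let $\|\cdot\|_f:X\times(0,\infty)\to[0,1]$ and $\|\cdot\|_g:Y\times(0,\infty)\to[0,1]$ be two mappings such that $\|(x,t)\|_f=\|(h(x),t)\|_g$ for all $x\in X$ and $t>0$. (i) If $h$ is surjective and $\|\cdot\|_f$ is a fuzzy BCK/BCI-norm on $X$, then $\|\cdot\|_g$ is a fuzzy BCK/BCI-norm on $Y$. (ii) If $h$ satisfies: for all $x\in X$, $h(x)=0_Y$ implies $x=0_X$; and $\|\cdot\|_g$ is a fuzzy BCK/BCI-norm on $Y$, then $\|\cdot\|_f$ is a fuzzy BCK/BCI-norm on $X$. (iii) If $h$ is injective and $\|\cdot\|_g$ is a fuzzy BCK/BCI-norm on $Y$, then $\|\cdot\|_f$ is a fuzzy BCK/BCI-norm on $X$.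
   Context: A BCI-algebra is a set $X$ with a binary operation $*$ and a distinguished element $0$ such that for all $a,b,c\in X$: (I1) $((a*b)*(a*c))*(c*b)=0$; (I2) $(a*(a*b))*b=0$; (I3) $a*a=0$; (I4) $a*b=0$ and $b*a=0$ imply $a=b$. A BCK-algebra is a BCI-algebra that also satisfies (K): $0*a=0$ for all $a\in X$. "BCK/BCI-algebra" means a BCK-algebra or a BCI-algebra. A homomorphism $h:X\to Y$ of BCK/BCI-algebras is a map with $h(a*_X b)=h(a)*_Y h(b)$ for all $a,b\in X$ (hence $h(0_X)=0_Y$). For a BCK-algebra or BCI-algebra $(X,*,0)$, a fuzzy BCK/BCI-norm on $X$ is a mapping $\|\cdot\|_f : X\times(0,\infty)\to[0,1]$, with values written $\|(x,t)\|_f$, satisfying for all $x,y,z\in X$ and $s,t\in(0,\infty)$: (FN1) $\|(x,t)\|_f=1$ if and only if $x=0$; (FN2) if $t\ge s$ then $\|(x,t)\|_f\ge\|(x,s)\|_f$; (FN3) $\lim_{t\to\infty}\|(x,t)\|_f=1$; (FN4) $\|(x*z,s+t)\|_f\ge\min\{\|(x*y,s)\|_f,\|(y*z,t)\|_f\}$. *)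

theory Defs
  imports Complex_Main "HOL-Library.FuncSet"
begin

locale bci_algebra =
  fixes X :: "'a set" and star :: "'a \<Rightarrow> 'a \<Rightarrow> 'a" (infixl "\<star>" 70) and zero :: 'a ("\<zero>")
  assumes star_closed: "\<lbrakk>a \<in> X; b \<in> X\<rbrakk> \<Longrightarrow> a \<star> b \<in> X"
    and zero_closed: "\<zero> \<in> X"
    and I1: "\<lbrakk>a \<in> X; b \<in> X; c \<in> X\<rbrakk> \<Longrightarrow> ((a \<star> b) \<star> (a \<star> c)) \<star> (c \<star> b) = \<zero>"
    and I2: "\<lbrakk>a \<in> X; b \<in> X\<rbrakk> \<Longrightarrow> (a \<star> (a \<star> b)) \<star> b = \<zero>"
    and I3: "a \<in> X \<Longrightarrow> a \<star> a = \<zero>"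
    and I4: "\<lbrakk>a \<in> X; b \<in> X; a \<star> b = \<zero>; b \<star> a = \<zero>\<rbrakk> \<Longrightarrow> a = b"

locale bck_algebra = bci_algebra +
  assumes K: "a \<in> X \<Longrightarrow> \<zero> \<star> a = \<zero>"

definition bck_bci_algebra :: "'a set \<Rightarrow> ('a \<Rightarrow> 'a \<Rightarrow> 'a) \<Rightarrow> 'a \<Rightarrow> bool" where
  "bck_bci_algebra X star zero \<longleftrightarrow> bck_algebra X star zero \<or> bci_algebra X star zero"

definition bck_bci_hom ::
  "'a set \<Rightarrow> ('a \<Rightarrow> 'a \<Rightarrow> 'a) \<Rightarrow> 'b set \<Rightarrow> ('b \<Rightarrow> 'b \<Rightarrow> 'b) \<Rightarrow> ('a \<Rightarrow> 'b) \<Rightarrow> bool" where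
  "bck_bci_hom X starX Y starY h \<longleftrightarrow>
     h \<in> X \<rightarrow> Y \<and> (\<forall>a\<in>X. \<forall>b\<in>X. h (starX a b) = starY (h a) (h b))"

text \<open>
  The values of \<open>N\<close> outside \<open>X \<times> {0<..}\<close> are unconstrained; the limit in the third axiom
  is along \<open>t \<rightarrow> \<infinity>\<close>, so it only depends on \<open>t > 0\<close>.
\<close>

definition fuzzy_bck_bci_norm ::
  "'a set \<Rightarrow> ('a \<Rightarrow> 'a \<Rightarrow> 'a) \<Rightarrow> 'a \<Rightarrow> ('a \<times> real \<Rightarrow> real) \<Rightarrow> bool" where
  "fuzzy_bck_bci_norm X star zero N \<longleftrightarrow>
     N \<in> X \<times> {0<..} \<rightarrow> {0..1} \<and>
     (\<forall>x\<in>X. \<forall>t>0. N (x, t) = 1 \<longleftrightarrow> x = zero) \<and>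
     (\<forall>x\<in>X. \<forall>s>0. \<forall>t>0. t \<ge> s \<longrightarrow> N (x, t) \<ge> N (x, s)) \<and>
     (\<forall>x\<in>X. ((\<lambda>t. N (x, t)) \<longlongrightarrow> 1) at_top) \<and>
     (\<forall>x\<in>X. \<forall>y\<in>X. \<forall>z\<in>X. \<forall>s>0. \<forall>t>0.
        N (star x z, s + t) \<ge> min (N (star x y, s)) (N (star y z, t)))"

end

theory Submission
  imports Defs
begin

text \<open>The relation \<open>Nf (x, t) = Ng (h x, t)\<close> says that \<open>Nf\<close> is the
  pullback of \<open>Ng\<close> along \<open>h\<close>. Monotonicity and the limit concern one point
  at a time, so they pass between \<open>x\<close> and \<open>h x\<close> unchanged. The
  triangle-type inequality passes because \<open>h\<close> carries \<open>starX\<close> to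
  \<open>starY\<close>. Only the axiom characterising the value 1 needs more: \<open>h\<close> sends
  zero to zero (\<open>bck_bci_hom_zero\<close>), and, for the passage from \<open>Y\<close> to
  \<open>X\<close>, only zero may go to zero. The passage from \<open>X\<close> to \<open>Y\<close>
  instead uses surjectivity, so that every point of \<open>Y\<close> has the form
  \<open>h x\<close>. An injective \<open>h\<close> has trivial kernel, so the third claim follows
  from the second.\<close>

lemma bck_bci_algebraD:
  assumes "bck_bci_algebra X star zero"
  shows "bci_algebra X star zero"
  using assms unfolding bck_bci_algebra_def bck_algebra_def by blast

lemma fuzzy_bck_bci_normD:
  assumes "fuzzy_bck_bci_norm X star zero N" and "x \<in> X"
  shows "t > 0 \<Longrightarrow> N (x, t) = 1 \<longleftrightarrow> x = zero"
    and "\<lbrakk>s > 0; s \<le> t\<rbrakk> \<Longrightarrow> N (x, s) \<le> N (x, t)"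
    and "((\<lambda>t. N (x, t)) \<longlongrightarrow> 1) at_top"
    and "\<lbrakk>y \<in> X; z \<in> X; s > 0; t > 0\<rbrakk> \<Longrightarrow>
      min (N (star x y, s)) (N (star y z, t)) \<le> N (star x z, s + t)"
  using assms by (simp_all add: fuzzy_bck_bci_norm_def)

text \<open>Since zero equals zero star zero in \<open>X\<close>, its image is some element of
  \<open>Y\<close> starred with itself, which is \<open>zeroY\<close> by \<open>I3\<close>.\<close>

lemma bck_bci_hom_zero:
  assumes X: "bci_algebra X starX zeroX" and Y: "bci_algebra Y starY zeroY"
    and hom: "bck_bci_hom X starX Y starY h"
  shows "h zeroX = zeroY"
proof -
  have 0: "zeroX \<in> X"
    using bci_algebra.zero_closed[OF X] .
  have "h zeroX = starY (h zeroX) (h zeroX)"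
    using hom 0 bci_algebra.I3[OF X 0] unfolding bck_bci_hom_def by metis
  also have "\<dots> = zeroY"
    using hom 0 by (auto simp: bck_bci_hom_def intro: bci_algebra.I3[OF Y])
  finally show ?thesis .
qed

text \<open>The two norms are related only for positive \<open>t\<close>; this suffices for limits
  at infinity, because \<open>t > 0\<close> holds eventually along \<open>at_top\<close>.\<close>

lemma tendsto_at_top_cong_pos:
  fixes f g :: "real \<Rightarrow> real"
  assumes "\<And>t. t > 0 \<Longrightarrow> f t = g t"
  shows "(f \<longlongrightarrow> l) at_top \<longleftrightarrow> (g \<longlongrightarrow> l) at_top"
  using assms by (intro tendsto_cong eventually_mono[OF eventually_gt_at_top[of 0]])

lemma fuzzy_bck_bci_norm_image:
  assumes X: "bci_algebra X starX zeroX" and Y: "bci_algebra Y starY zeroY"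
    and hom: "bck_bci_hom X starX Y starY h"
    and Ng: "Ng \<in> Y \<times> {0<..} \<rightarrow> {0..1}"
    and eq: "\<And>x t. \<lbrakk>x \<in> X; t > 0\<rbrakk> \<Longrightarrow> Nf (x, t) = Ng (h x, t)"
    and surj: "h ` X = Y" and Nf: "fuzzy_bck_bci_norm X starX zeroX Nf"
  shows "fuzzy_bck_bci_norm Y starY zeroY Ng"
proof -
  have 0: "zeroX \<in> X"
    using bci_algebra.zero_closed[OF X] .
  have h0: "h zeroX = zeroY"
    using bck_bci_hom_zero[OF X Y hom] .
  have star: "starX a b \<in> X" "h (starX a b) = starY (h a) (h b)" if "a \<in> X" "b \<in> X" for a b
    using that hom bci_algebra.star_closed[OF X] by (auto simp: bck_bci_hom_def)
  have N1: "Nf (x, t) = 1 \<longleftrightarrow> x = zeroX" if "x \<in> X" "t > 0" for x t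
    using fuzzy_bck_bci_normD(1)[OF Nf that] .
  \<comment> \<open>If the value is 1, then \<open>Nf (x, t) = 1\<close>, so \<open>x\<close> is
    zero and \<open>h x = zeroY\<close>. Conversely, \<open>h x = zeroY\<close> means
    \<open>h x = h zeroX\<close>, so the value equals \<open>Nf (zeroX, t)\<close>, which is 1;
    triviality of the kernel is not assumed here.\<close>
  have "Ng (h x, t) = 1 \<longleftrightarrow> h x = zeroY" if "x \<in> X" "t > 0" for x t
    using N1[OF that] N1[OF 0 \<open>t > 0\<close>] eq[OF that] eq[OF 0 \<open>t > 0\<close>] h0 by auto
  moreover have "Ng (h x, s) \<le> Ng (h x, t)" if "x \<in> X" "s > 0" "t > 0" "s \<le> t" for x s t
    using fuzzy_bck_bci_normD(2)[OF Nf that(1,2,4)] that by (simp add: eq)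
  moreover have "((\<lambda>t. Ng (h x, t)) \<longlongrightarrow> 1) at_top" if "x \<in> X" for x
    using fuzzy_bck_bci_normD(3)[OF Nf that] eq[OF that]
      tendsto_at_top_cong_pos[where f = "\<lambda>t. Nf (x, t)" and g = "\<lambda>t. Ng (h x, t)"]
    by simp
  moreover have "min (Ng (starY (h x) (h y), s)) (Ng (starY (h y) (h z), t))
      \<le> Ng (starY (h x) (h z), s + t)"
    if "x \<in> X" "y \<in> X" "z \<in> X" "s > 0" "t > 0" for x y z s t
  proof -
    have "min (Nf (starX x y, s)) (Nf (starX y z, t)) \<le> Nf (starX x z, s + t)"
      using fuzzy_bck_bci_normD(4)[OF Nf that] .
    then show ?thesis
      using that by (simp add: eq star)
  qed
  ultimately show ?thesis
    using Ng unfolding fuzzy_bck_bci_norm_def surj[symmetric] by simp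
qed

lemma fuzzy_bck_bci_norm_vimage:
  assumes X: "bci_algebra X starX zeroX" and Y: "bci_algebra Y starY zeroY"
    and hom: "bck_bci_hom X starX Y starY h"
    and Nf: "Nf \<in> X \<times> {0<..} \<rightarrow> {0..1}"
    and eq: "\<And>x t. \<lbrakk>x \<in> X; t > 0\<rbrakk> \<Longrightarrow> Nf (x, t) = Ng (h x, t)"
    and ker: "\<And>x. \<lbrakk>x \<in> X; h x = zeroY\<rbrakk> \<Longrightarrow> x = zeroX"
    and Ng: "fuzzy_bck_bci_norm Y starY zeroY Ng"
  shows "fuzzy_bck_bci_norm X starX zeroX Nf"
proof -
  have hX: "h x \<in> Y" if "x \<in> X" for x
    using hom that by (auto simp: bck_bci_hom_def)
  have h0: "h zeroX = zeroY"
    using bck_bci_hom_zero[OF X Y hom] .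
  have star: "starX a b \<in> X" "h (starX a b) = starY (h a) (h b)" if "a \<in> X" "b \<in> X" for a b
    using that hom bci_algebra.star_closed[OF X] by (auto simp: bck_bci_hom_def)
  have "Nf (x, t) = 1 \<longleftrightarrow> x = zeroX" if "x \<in> X" "t > 0" for x t
  proof -
    have "Ng (h x, t) = 1 \<longleftrightarrow> h x = zeroY"
      using fuzzy_bck_bci_normD(1)[OF Ng hX] that by blast
    \<comment> \<open>\<open>h x = zeroY\<close> is equivalent to \<open>x = zeroX\<close>: one
      direction is the kernel condition \<open>ker\<close>, the other is \<open>h0\<close>.\<close>
    then show ?thesis
      using eq[OF that] ker[OF \<open>x \<in> X\<close>] h0 by auto
  qed
  moreover have "Nf (x, s) \<le> Nf (x, t)" if "x \<in> X" "s > 0" "t > 0" "s \<le> t" for x s t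
    using fuzzy_bck_bci_normD(2)[OF Ng hX] that by (simp add: eq)
  moreover have "((\<lambda>t. Nf (x, t)) \<longlongrightarrow> 1) at_top" if "x \<in> X" for x
    using fuzzy_bck_bci_normD(3)[OF Ng hX[OF that]] eq[OF that]
      tendsto_at_top_cong_pos[where f = "\<lambda>t. Nf (x, t)" and g = "\<lambda>t. Ng (h x, t)"]
    by simp
  moreover have "min (Nf (starX x y, s)) (Nf (starX y z, t)) \<le> Nf (starX x z, s + t)"
    if "x \<in> X" "y \<in> X" "z \<in> X" "s > 0" "t > 0" for x y z s t
  proof -
    have "min (Ng (starY (h x) (h y), s)) (Ng (starY (h y) (h z), t))
        \<le> Ng (starY (h x) (h z), s + t)"
      using fuzzy_bck_bci_normD(4)[OF Ng] hX that by blast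
    then show ?thesis
      using that by (simp add: eq star)
  qed
  ultimately show ?thesis
    using Nf unfolding fuzzy_bck_bci_norm_def by simp
qed

theorem theorem3p15:
  fixes X :: "'a set" and starX :: "'a \<Rightarrow> 'a \<Rightarrow> 'a" and zeroX :: 'a
    and Y :: "'b set" and starY :: "'b \<Rightarrow> 'b \<Rightarrow> 'b" and zeroY :: 'b
    and h :: "'a \<Rightarrow> 'b"
    and Nf :: "'a \<times> real \<Rightarrow> real" and Ng :: "'b \<times> real \<Rightarrow> real"
  assumes "bck_bci_algebra X starX zeroX"
    and "bck_bci_algebra Y starY zeroY"
    and "bck_bci_hom X starX Y starY h"
    and "Nf \<in> X \<times> {0<..} \<rightarrow> {0..1}"
    and "Ng \<in> Y \<times> {0<..} \<rightarrow> {0..1}"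
    and "\<forall>x\<in>X. \<forall>t>0. Nf (x, t) = Ng (h x, t)"
  shows "(h ` X = Y \<and> fuzzy_bck_bci_norm X starX zeroX Nf \<longrightarrow>
            fuzzy_bck_bci_norm Y starY zeroY Ng) \<and>
         ((\<forall>x\<in>X. h x = zeroY \<longrightarrow> x = zeroX) \<and> fuzzy_bck_bci_norm Y starY zeroY Ng \<longrightarrow>
            fuzzy_bck_bci_norm X starX zeroX Nf) \<and>
         (inj_on h X \<and> fuzzy_bck_bci_norm Y starY zeroY Ng \<longrightarrow>
            fuzzy_bck_bci_norm X starX zeroX Nf)"
proof -
  note X = bck_bci_algebraD[OF assms(1)] and Y = bck_bci_algebraD[OF assms(2)]
  have eq: "Nf (x, t) = Ng (h x, t)" if "x \<in> X" "t > 0" for x t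
    using assms(6) that by blast
  have image: "fuzzy_bck_bci_norm Y starY zeroY Ng"
    if "h ` X = Y" "fuzzy_bck_bci_norm X starX zeroX Nf"
    using fuzzy_bck_bci_norm_image[OF X Y assms(3) assms(5) eq that] .
  have vimage: "fuzzy_bck_bci_norm X starX zeroX Nf"
    if "\<forall>x\<in>X. h x = zeroY \<longrightarrow> x = zeroX" "fuzzy_bck_bci_norm Y starY zeroY Ng"
    using fuzzy_bck_bci_norm_vimage[OF X Y assms(3) assms(4) eq _ that(2)] that(1) by blast
  \<comment> \<open>If \<open>h x = zeroY\<close>, then \<open>x\<close> and \<open>zeroX\<close>
    have the same image, so injectivity on \<open>X\<close> identifies them.\<close>
  have "\<forall>x\<in>X. h x = zeroY \<longrightarrow> x = zeroX" if "inj_on h X"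
    using inj_onD[OF that] bck_bci_hom_zero[OF X Y assms(3)] bci_algebra.zero_closed[OF X] by metis
  with image vimage show ?thesis
    by blast
qed

end
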